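(* Let $G$ be an $r$-regular interval colorable graph and let $m$ be a positive integer. Then $G\square P_m$ is interval colorable and $$W(G\square P_m)\geq W(G)+W(P_m)+(m-1)r,$$ where $W(P_m)=m-1$.
   Context: All graphs are finite, undirected, without loops or multiple edges. An edge-coloring of a graph $G$ with colors $1,\ldots,t$ is an interval $t$-coloring if all $t$ colors are used, and the colors of the edges incident to each vertex are distinct and form an interval of consecutive integers. A graph is interval colorable if it has an interval $t$-coloring for some positive integer $t$; for such a graph, $W(G)$ is the greatest such $t$. $P_m$ is the path on $m$ vertices, and the value $W(P_m)$ is taken to be $m-1$. The Cartesian product $G\square H$ has vertex set $V(G)\times V(H)$, with $(u_1,v_1)(u_2,v_2)$ an edge iff either $u_1=u_2$ and $v_1v_2\in E(H)$, or $v_1=v_2$ and $u_1u_2\in E(G)$. *)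

theory Defs
  imports Main
begin

record 'a ugraph =
  verts :: "'a set"
  edges :: "'a set set"

definition simple_graph :: "'a ugraph \<Rightarrow> bool" where
  "simple_graph G \<longleftrightarrow> finite (verts G) \<and>
     (\<forall>e\<in>edges G. \<exists>u\<in>verts G. \<exists>v\<in>verts G. u \<noteq> v \<and> e = {u, v})"

definition incident_edges :: "'a ugraph \<Rightarrow> 'a \<Rightarrow> 'a set set" where
  "incident_edges G v = {e \<in> edges G. v \<in> e}"

definition regular :: "nat \<Rightarrow> 'a ugraph \<Rightarrow> bool" where
  "regular r G \<longleftrightarrow> (\<forall>v\<in>verts G. card (incident_edges G v) = r)"

text \<open>In the last condition \<open>a > b\<close> is possible only at an isolated vertex, where the
  set of colours is empty.\<close>

definition interval_coloring :: "'a ugraph \<Rightarrow> nat \<Rightarrow> ('a set \<Rightarrow> nat) \<Rightarrow> bool" where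
  "interval_coloring G t c \<longleftrightarrow>
     c ` edges G = {1..t} \<and>
     (\<forall>v\<in>verts G. inj_on c (incident_edges G v) \<and>
        (\<exists>a b. c ` incident_edges G v = {a..b}))"

definition interval_colorable :: "'a ugraph \<Rightarrow> bool" where
  "interval_colorable G \<longleftrightarrow> (\<exists>t>0. \<exists>c. interval_coloring G t c)"

text \<open>For an interval colorable simple graph the set below is finite and nonempty, so the
  maximum is attained. An edgeless graph is not interval colorable, because \<open>t\<close> has to be
  positive; the default value 0 gives the one-vertex path the usual value \<open>W = 0\<close>.\<close>

definition W :: "'a ugraph \<Rightarrow> nat" where
  "W G = (if interval_colorable G
          then Max {t. t > 0 \<and> (\<exists>c. interval_coloring G t c)} else 0)"

lemma finite_interval_coloring_sizes:
  assumes "simple_graph G"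
  shows "finite {t. t > 0 \<and> (\<exists>c. interval_coloring G t c)}"
proof -
  have fin_verts: "finite (verts G)"
    using assms unfolding simple_graph_def by (rule conjunct1)
  have "edges G \<subseteq> Pow (verts G)"
  proof
    fix e assume "e \<in> edges G"
    then have "\<exists>u\<in>verts G. \<exists>v\<in>verts G. u \<noteq> v \<and> e = {u, v}"
      using assms unfolding simple_graph_def by blast
    then show "e \<in> Pow (verts G)" by blast
  qed
  then have fin: "finite (edges G)"
    using fin_verts by (rule finite_subset[OF _ finite_Pow_iff[THEN iffD2]])
  have "t \<le> card (edges G)" if "interval_coloring G t c" for t c
  proof -
    have img: "c ` edges G = {1..t}"
      using that unfolding interval_coloring_def by (rule conjunct1)
    have "card {1..t} \<le> card (edges G)"
      unfolding img[symmetric] using fin by (rule card_image_le)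
    then show ?thesis by simp
  qed
  then have "{t. t > 0 \<and> (\<exists>c. interval_coloring G t c)} \<subseteq> {..card (edges G)}"
    by blast
  then show ?thesis
    by (rule finite_subset) (rule finite_atMost)
qed

definition path_graph :: "nat \<Rightarrow> nat ugraph" where
  "path_graph m = \<lparr>verts = {0..<m}, edges = {{i, Suc i} | i. Suc i < m}\<rparr>"

definition cartesian_product :: "'a ugraph \<Rightarrow> 'b ugraph \<Rightarrow> ('a \<times> 'b) ugraph"
    (infixl "\<box>" 70) where
  "G \<box> H =
     \<lparr>verts = verts G \<times> verts H,
      edges = {{(u\<^sub>1, v\<^sub>1), (u\<^sub>2, v\<^sub>2)} | u\<^sub>1 v\<^sub>1 u\<^sub>2 v\<^sub>2.
        u\<^sub>1 \<in> verts G \<and> v\<^sub>1 \<in> verts H \<and> u\<^sub>2 \<in> verts G \<and> v\<^sub>2 \<in> verts H \<and>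
        (u\<^sub>1 = u\<^sub>2 \<and> {v\<^sub>1, v\<^sub>2} \<in> edges H \<or> v\<^sub>1 = v\<^sub>2 \<and> {u\<^sub>1, u\<^sub>2} \<in> edges G)}\<rparr>"

end

theory Submission imports Defs begin

text \<open>Take an interval colouring \<open>\<alpha>\<close> of \<open>G\<close> with \<open>W G\<close> colours, in which the colours at \<open>v\<close> form
  the interval \<open>{a v..<a v + r}\<close>. Shift \<open>\<alpha>\<close> by \<open>i * (r + 1)\<close> on the \<open>i\<close>-th copy of \<open>G\<close>, and give
  the path edge from the \<open>i\<close>-th to the next copy at \<open>v\<close> the colour \<open>a v + r + i * (r + 1)\<close>. This
  colour comes right after those at \<open>v\<close> in copy \<open>i\<close> and right before those at \<open>v\<close> in copy
  \<open>i + 1\<close>, so each vertex still sees an interval; the largest colour is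
  \<open>W G + (m - 1) * (r + 1)\<close>.\<close>

section \<open>Edges of simple graphs and the maximum \<open>W\<close>\<close>

lemma simple_graph_edgeE:
  assumes "simple_graph G" "e \<in> edges G"
  obtains u v where "u \<in> verts G" "v \<in> verts G" "u \<noteq> v" "e = {u, v}"
  using assms unfolding simple_graph_def by blast

lemma finite_edges:
  assumes "simple_graph G"
  shows "finite (edges G)"
proof -
  have "edges G \<subseteq> Pow (verts G)"
    by (auto elim: simple_graph_edgeE[OF assms])
  moreover have "finite (verts G)"
    using assms by (simp add: simple_graph_def)
  ultimately show ?thesis
    by (meson finite_Pow_iff finite_subset)
qed

text \<open>Each of the \<open>t\<close> colours occurs on some edge. For paths this bound is sharp,
  which determines their \<open>W\<close>.\<close>

lemma interval_coloring_le_card_edges: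
  assumes "simple_graph G" "interval_coloring G t c"
  shows "t \<le> card (edges G)"
proof -
  have "card (c ` edges G) = t"
    using assms(2) by (simp add: interval_coloring_def)
  then show ?thesis
    using card_image_le[OF finite_edges[OF assms(1)], of c] by simp
qed

lemma W_ge:
  assumes "simple_graph G" "interval_coloring G t c" "t > 0"
  shows "t \<le> W G"
proof -
  have "interval_colorable G"
    using assms by (auto simp: interval_colorable_def)
  then show ?thesis
    using assms finite_interval_coloring_sizes[OF assms(1)]
    by (auto simp: W_def intro!: Max_ge)
qed

lemma W_attained:
  assumes "simple_graph G" "interval_colorable G"
  obtains c where "interval_coloring G (W G) c" "W G > 0"
proof -
  let ?S = "{t. t > 0 \<and> (\<exists>c. interval_coloring G t c)}"
  have "Max ?S \<in> ?S"
    using assms(2) finite_interval_coloring_sizes[OF assms(1)]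
    by (intro Max_in) (auto simp: interval_colorable_def)
  then show ?thesis
    using that assms(2) by (auto simp: W_def)
qed

subsection \<open>Paths\<close>

lemma verts_path_graph [simp]: "verts (path_graph m) = {..<m}"
  by (auto simp: path_graph_def)

lemma edges_path_graph: "edges (path_graph m) = (\<lambda>i. {i, Suc i}) ` {i. Suc i < m}"
  by (auto simp: path_graph_def)

lemma simple_path_graph: "simple_graph (path_graph m)"
proof -
  have "\<exists>u\<in>{..<m}. \<exists>v\<in>{..<m}. u \<noteq> v \<and> {i, Suc i} = {u, v}" if "Suc i < m" for i
    using that by (intro bexI[of _ i] bexI[of _ "Suc i"]) auto
  then show ?thesis
    by (auto simp: simple_graph_def edges_path_graph)
qed

lemma incident_edges_path_graph:
  "incident_edges (path_graph m) j = (\<lambda>i. {i, Suc i}) ` {i. Suc i < m \<and> (i = j \<or> Suc i = j)}"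
  by (auto simp: incident_edges_def edges_path_graph)

lemma card_edges_path_graph: "card (edges (path_graph m)) = m - 1"
proof -
  have "inj (\<lambda>i::nat. {i, Suc i})"
    by (auto simp: inj_def doubleton_eq_iff)
  then have "card (edges (path_graph m)) = card {i. Suc i < m}"
    unfolding edges_path_graph by (intro card_image) (auto intro: inj_on_subset)
  also have "{i. Suc i < m} = {..<m - 1}"
    by auto
  finally show ?thesis by simp
qed

text \<open>\<open>Max\<close> gives the edge \<open>{i, Suc i}\<close> the colour
  \<open>Suc i\<close>, so the colours run in order along the path. A path without edges gets the
  empty range \<open>{1..0}\<close>.\<close>

lemma interval_coloring_path_graph: "interval_coloring (path_graph m) (m - 1) Max"
  unfolding interval_coloring_def
proof (intro conjI ballI)
  have "Max ` edges (path_graph m) = Suc ` {i. Suc i < m}"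
    by (simp add: edges_path_graph image_image)
  also have "\<dots> = {1..m - 1}"
  proof (intro equalityI subsetI)
    fix k assume "k \<in> {1..m - 1}"
    then show "k \<in> Suc ` {i. Suc i < m}"
      by (cases k) auto
  qed auto
  finally show "Max ` edges (path_graph m) = {1..m - 1}" .
next
  fix j assume "j \<in> verts (path_graph m)"
  show "inj_on Max (incident_edges (path_graph m) j)"
    by (auto simp: inj_on_def incident_edges_path_graph)
  have "Max ` incident_edges (path_graph m) j = Suc ` {i. Suc i < m \<and> (i = j \<or> Suc i = j)}"
    by (simp add: incident_edges_path_graph image_image)
  \<comment> \<open>The edges to the left and right of \<open>j\<close> have colours
    \<open>j\<close> and \<open>Suc j\<close>; \<open>max\<close> and \<open>min\<close> remove the
    missing one at an end of the path.\<close>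
  also have "\<dots> = {max 1 j..min (Suc j) (m - 1)}"
  proof (intro equalityI subsetI)
    fix k assume "k \<in> {max 1 j..min (Suc j) (m - 1)}"
    then show "k \<in> Suc ` {i. Suc i < m \<and> (i = j \<or> Suc i = j)}"
      by (cases k) auto
  qed auto
  finally show "\<exists>a b. Max ` incident_edges (path_graph m) j = {a..b}"
    by blast
qed

lemma W_path_graph: "W (path_graph m) = m - 1"
proof (cases "m - 1 > 0")
  case True
  obtain c where "interval_coloring (path_graph m) (W (path_graph m)) c"
    using True W_attained[OF simple_path_graph] interval_coloring_path_graph
    by (metis interval_colorable_def)
  then have "W (path_graph m) \<le> m - 1"
    using interval_coloring_le_card_edges[OF simple_path_graph]
    by (metis card_edges_path_graph)
  moreover have "m - 1 \<le> W (path_graph m)"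
    using W_ge[OF simple_path_graph interval_coloring_path_graph True] .
  ultimately show ?thesis by simp
next
  case False
  \<comment> \<open>Without edges no positive \<open>t\<close> is possible, and the default value 0
    of \<open>W\<close> equals the truncated \<open>m - 1\<close>.\<close>
  then have "\<not> interval_colorable (path_graph m)"
    using interval_coloring_le_card_edges[OF simple_path_graph, of m]
    by (fastforce simp: interval_colorable_def card_edges_path_graph)
  with False show ?thesis by (simp add: W_def)
qed

subsection \<open>Cartesian products\<close>

lemma verts_cartesian_product [simp]: "verts (G \<box> H) = verts G \<times> verts H"
  by (simp add: cartesian_product_def)

text \<open>Writing edges as products of sets lets the images under \<open>fst\<close> and
  \<open>snd\<close> recover the edge of the factor and the position of its copy.\<close>

lemma edges_cartesian_product:
  assumes G: "simple_graph G" and H: "simple_graph H"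
  shows "edges (G \<box> H) =
    {e \<times> {v} | e v. e \<in> edges G \<and> v \<in> verts H} \<union> {{u} \<times> f | u f. u \<in> verts G \<and> f \<in> edges H}"
    (is "_ = ?A \<union> ?B")
proof (intro equalityI subsetI)
  fix x assume "x \<in> edges (G \<box> H)"
  then obtain u1 v1 u2 v2 where x: "x = {(u1, v1), (u2, v2)}"
    and V: "u1 \<in> verts G" "v1 \<in> verts H" "u2 \<in> verts G" "v2 \<in> verts H"
    and E: "u1 = u2 \<and> {v1, v2} \<in> edges H \<or> v1 = v2 \<and> {u1, u2} \<in> edges G"
    by (auto simp: cartesian_product_def)
  from E show "x \<in> ?A \<union> ?B"
  proof (elim disjE conjE)
    assume "u1 = u2" "{v1, v2} \<in> edges H"
    moreover from this x have "x = {u1} \<times> {v1, v2}" by auto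
    ultimately show ?thesis using V by blast
  next
    assume "v1 = v2" "{u1, u2} \<in> edges G"
    moreover from this x have "x = {u1, u2} \<times> {v1}" by auto
    ultimately show ?thesis using V by blast
  qed
next
  fix x assume "x \<in> ?A \<union> ?B"
  then show "x \<in> edges (G \<box> H)"
  proof
    assume "x \<in> ?A"
    then obtain e v where *: "x = e \<times> {v}" "e \<in> edges G" "v \<in> verts H" by blast
    then obtain u1 u2 where e: "u1 \<in> verts G" "u2 \<in> verts G" "e = {u1, u2}"
      using G by (elim simple_graph_edgeE)
    have "x = {(u1, v), (u2, v)}" using * e by auto
    then show ?thesis using * e by (auto simp: cartesian_product_def)
  next
    assume "x \<in> ?B"
    then obtain u f where *: "x = {u} \<times> f" "f \<in> edges H" "u \<in> verts G" by blast
    then obtain v1 v2 where f: "v1 \<in> verts H" "v2 \<in> verts H" "f = {v1, v2}"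
      using H by (elim simple_graph_edgeE)
    have "x = {(u, v1), (u, v2)}" using * f by auto
    then show ?thesis using * f by (auto simp: cartesian_product_def)
  qed
qed

lemma simple_cartesian_product:
  assumes "simple_graph G" "simple_graph H"
  shows "simple_graph (G \<box> H)"
  unfolding simple_graph_def
proof (intro conjI ballI)
  show "finite (verts (G \<box> H))"
    using assms by (simp add: simple_graph_def)
next
  fix x assume "x \<in> edges (G \<box> H)"
  then obtain u1 v1 u2 v2 where x: "x = {(u1, v1), (u2, v2)}"
    and V: "u1 \<in> verts G" "v1 \<in> verts H" "u2 \<in> verts G" "v2 \<in> verts H"
    and E: "u1 = u2 \<and> {v1, v2} \<in> edges H \<or> v1 = v2 \<and> {u1, u2} \<in> edges G"
    by (auto simp: cartesian_product_def)
  have "(u1, v1) \<noteq> (u2, v2)"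
    using E by (auto elim: simple_graph_edgeE[OF assms(1)] simple_graph_edgeE[OF assms(2)])
  then show "\<exists>u\<in>verts (G \<box> H). \<exists>v\<in>verts (G \<box> H). u \<noteq> v \<and> x = {u, v}"
    using x V by auto
qed

lemma incident_edges_cartesian_product:
  assumes "simple_graph G" "simple_graph H" "u \<in> verts G" "v \<in> verts H"
  shows "incident_edges (G \<box> H) (u, v) =
    (\<lambda>e. e \<times> {v}) ` incident_edges G u \<union> (\<lambda>f. {u} \<times> f) ` incident_edges H v"
  using assms(3,4) unfolding incident_edges_def edges_cartesian_product[OF assms(1,2)] by blast

subsection \<open>The colouring of the product\<close>

text \<open>By injectivity the interval at \<open>v\<close> has exactly \<open>r\<close> colours, so
  its first colour determines it, and \<open>a + r\<close> is the next free colour.\<close>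

lemma regular_interval_coloring_spectrum:
  assumes "regular r G" "interval_coloring G t c" "v \<in> verts G" "r > 0"
  shows "\<exists>a. c ` incident_edges G v = {a..<a + r}"
proof -
  obtain a b where ab: "c ` incident_edges G v = {a..b}" and "inj_on c (incident_edges G v)"
    using assms(2,3) unfolding interval_coloring_def by blast
  then have "card {a..b} = card (incident_edges G v)"
    by (metis card_image)
  also have "\<dots> = r"
    using assms by (simp add: regular_def)
  finally have "Suc b - a = r" by simp
  \<comment> \<open>Positivity of \<open>r\<close> excludes truncation in \<open>Suc b - a\<close>,
    so \<open>Suc b = a + r\<close>.\<close>
  with \<open>r > 0\<close> have "{a..b} = {a..<a + r}" by auto
  with ab show ?thesis by auto
qed

text \<open>Copies of edges of \<open>G\<close> are recognised by having a single second coordinate.\<close>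

definition product_coloring ::
    "nat \<Rightarrow> ('a set \<Rightarrow> nat) \<Rightarrow> ('a \<Rightarrow> nat) \<Rightarrow> ('a \<times> nat) set \<Rightarrow> nat" where
  "product_coloring r \<alpha> a x =
     (if is_singleton (snd ` x) then \<alpha> (fst ` x) else a (the_elem (fst ` x)) + r)
       + Min (snd ` x) * Suc r"

lemma product_coloring_copy:
  "e \<noteq> {} \<Longrightarrow> product_coloring r \<alpha> a (e \<times> {i}) = \<alpha> e + i * Suc r"
  by (simp add: product_coloring_def)

text \<open>The two second coordinates differ, so the set is not taken for a copied edge, and
  \<open>Min\<close> picks the lower copy \<open>i\<close>.\<close>

lemma product_coloring_rung:
  "product_coloring r \<alpha> a ({v} \<times> {i, Suc i}) = a v + r + i * Suc r"
proof -
  have "\<not> is_singleton {i, Suc i}"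
    by (auto simp: is_singleton_def doubleton_eq_iff)
  moreover have "snd ` ({v} \<times> {i, Suc i}) = {i, Suc i}" "fst ` ({v} \<times> {i, Suc i}) = {v}"
    by auto
  ultimately show ?thesis
    by (simp add: product_coloring_def)
qed

lemma interval_coloring_product:
  fixes m :: nat
  assumes G: "simple_graph G" and reg: "regular r G" and col: "interval_coloring G t \<alpha>"
    and "t > 0" "m \<ge> 1"
  shows "\<exists>c. interval_coloring (G \<box> path_graph m) (t + (m - 1) * Suc r) c"
proof -
  have img: "\<alpha> ` edges G = {1..t}"
    using col by (simp add: interval_coloring_def)
  \<comment> \<open>Colour 1 is used, so there is an edge; its endpoint \<open>v0\<close> has
    positive degree, whence \<open>r > 0\<close>.\<close>
  then obtain e0 where e0: "e0 \<in> edges G"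
    using \<open>t > 0\<close> by force
  then obtain v0 where v0: "v0 \<in> verts G" "e0 \<in> incident_edges G v0"
    using simple_graph_edgeE[OF G e0] by (auto simp: incident_edges_def)
  have "finite (incident_edges G v0)"
    using finite_edges[OF G] by (simp add: incident_edges_def)
  with v0 reg have "r > 0"
    by (metis regular_def card_gt_0_iff empty_iff)
  then have "\<forall>v\<in>verts G. \<exists>a. \<alpha> ` incident_edges G v = {a..<a + r}"
    using regular_interval_coloring_spectrum[OF reg col] by blast
  then obtain a where a: "\<And>v. v \<in> verts G \<Longrightarrow> \<alpha> ` incident_edges G v = {a v..<a v + r}"
    by metis
  have a_bounds: "1 \<le> a v" "a v + r \<le> Suc t" if "v \<in> verts G" for v
  proof -
    have "{a v..<a v + r} \<subseteq> {1..t}"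
      using a[OF that] img by (auto simp: incident_edges_def)
    moreover have "a v \<in> {a v..<a v + r}" "a v + r - 1 \<in> {a v..<a v + r}"
      using \<open>r > 0\<close> by auto
    ultimately have "a v \<in> {1..t}" "a v + r - 1 \<in> {1..t}" by blast+
    then show "1 \<le> a v" "a v + r \<le> Suc t" by auto
  qed
  define c where "c = product_coloring r \<alpha> a"
  have c_copy: "c (e \<times> {i}) = \<alpha> e + i * Suc r" if "e \<in> edges G" for e i
    unfolding c_def using simple_graph_edgeE[OF G that] by (intro product_coloring_copy) blast
  have c_rung: "c ({v} \<times> {i, Suc i}) = a v + r + i * Suc r" for v i
    unfolding c_def by (rule product_coloring_rung)
  note edges = edges_cartesian_product[OF G simple_path_graph]
  let ?T = "t + (m - 1) * Suc r"
  have "c ` edges (G \<box> path_graph m) = {1..?T}"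
  proof (intro equalityI subsetI)
    fix k assume "k \<in> c ` edges (G \<box> path_graph m)"
    then consider e i where "k = c (e \<times> {i})" "e \<in> edges G" "i < m"
      | v i where "k = c ({v} \<times> {i, Suc i})" "v \<in> verts G" "Suc i < m"
      unfolding edges edges_path_graph by auto
    then show "k \<in> {1..?T}"
    proof cases
      case 1
      have "\<alpha> e \<in> {1..t}" using img 1 by blast
      moreover have "i * Suc r \<le> (m - 1) * Suc r" using 1 by (intro mult_right_mono) auto
      ultimately show ?thesis using 1 by (auto simp: c_copy)
    next
      case 2
      \<comment> \<open>A rung starts below the last copy, which leaves room \<open>Suc r\<close>
        for a colour \<open>a v + r\<close> that may be \<open>Suc t\<close>.\<close>
      have "Suc i * Suc r \<le> (m - 1) * Suc r" using 2 by (intro mult_right_mono) auto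
      moreover have "k = a v + r + i * Suc r" using 2 c_rung by blast
      ultimately show ?thesis using a_bounds[OF 2(2)] by auto
    qed
  next
    fix k assume k: "k \<in> {1..?T}"
    \<comment> \<open>The last copy whose shift is below \<open>k\<close>; \<open>j\<close> is then
      the unshifted colour. If the cap \<open>m - 1\<close> is attained, \<open>k \<le> ?T\<close>
      gives \<open>j \<le> t\<close>.\<close>
    define i where "i = min ((k - 1) div Suc r) (m - 1)"
    define j where "j = k - i * Suc r"
    have "i * Suc r \<le> (k - 1) div Suc r * Suc r"
      unfolding i_def by (intro mult_right_mono) auto
    also have "\<dots> \<le> k - 1" by (rule div_times_less_eq_dividend)
    finally have kj: "k = j + i * Suc r" "j \<ge> 1"
      using k by (auto simp: j_def)
    have "i < m" using \<open>m \<ge> 1\<close> by (auto simp: i_def)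
    show "k \<in> c ` edges (G \<box> path_graph m)"
    proof (cases "j \<le> t")
      case True
      with kj img have "j \<in> \<alpha> ` edges G" by simp
      then obtain e where "e \<in> edges G" "\<alpha> e = j" by blast
      then have "c (e \<times> {i}) = k" "e \<times> {i} \<in> edges (G \<box> path_graph m)"
        using kj c_copy \<open>i < m\<close> by (auto simp: edges)
      then show ?thesis by blast
    next
      text \<open>Only the colour \<open>r + 1\<close> can be missed by the copies, when \<open>t = r\<close>; then \<open>a v0 = 1\<close>.\<close>
      case False
      have "i \<noteq> m - 1" using False k kj by auto
      then have "i = (k - 1) div Suc r" and "Suc i < m"
        using \<open>i < m\<close> by (auto simp: i_def min_def split: if_splits)
      then have "k - 1 < Suc r + i * Suc r"
        using dividend_less_div_times[of "Suc r" "k - 1"] by simp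
      then have "j \<le> Suc r" using kj by simp
      \<comment> \<open>The chain
        \<open>Suc r \<le> a v0 + r \<le> Suc t \<le> j \<le> Suc r\<close> collapses.\<close>
      with False a_bounds[OF v0(1)] have "j = a v0 + r" by linarith
      then have "c ({v0} \<times> {i, Suc i}) = k" using kj c_rung by simp
      moreover have "{v0} \<times> {i, Suc i} \<in> edges (G \<box> path_graph m)"
        unfolding edges edges_path_graph using v0 \<open>Suc i < m\<close> by blast
      ultimately show ?thesis by blast
    qed
  qed
  moreover have "inj_on c (incident_edges (G \<box> path_graph m) (v, j)) \<and>
      (\<exists>p q. c ` incident_edges (G \<box> path_graph m) (v, j) = {p..q})"
    if v: "v \<in> verts G" and j: "j < m" for v j
  proof -
    define A where "A = (\<lambda>e. e \<times> {j}) ` incident_edges G v"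
    define R where "R = (\<lambda>i. {v} \<times> {i, Suc i}) ` {i. Suc i < m \<and> (i = j \<or> Suc i = j)}"
    have inc: "incident_edges (G \<box> path_graph m) (v, j) = A \<union> R"
      using incident_edges_cartesian_product[OF G simple_path_graph v, of j m] j
      by (simp add: A_def R_def incident_edges_path_graph image_image)
    have E: "e \<in> edges G" if "e \<in> incident_edges G v" for e
      using that by (simp add: incident_edges_def)
    define s where "s = a v + j * Suc r"
    have "c ` A = (\<lambda>x. x + j * Suc r) ` \<alpha> ` incident_edges G v"
      unfolding A_def image_image using c_copy E by (intro image_cong) auto
    also have "\<dots> = {s..<s + r}"
      using a[OF v] by (simp add: s_def add.assoc add.commute add.left_commute)
    finally have cA: "c ` A = {s..<s + r}" .
    have "{i. Suc i < m \<and> (i = j \<or> Suc i = j)} =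
        (if j = 0 then {} else {j - 1}) \<union> (if Suc j < m then {j} else {})"
      using j by auto
    then have "c ` R = (\<lambda>i. a v + r + i * Suc r) `
        ((if j = 0 then {} else {j - 1}) \<union> (if Suc j < m then {j} else {}))"
      unfolding R_def image_image c_rung by (rule arg_cong)
    \<comment> \<open>The shift drops by \<open>Suc r\<close> from copy \<open>j\<close> to copy
      \<open>j - 1\<close>, so the lower rung has colour
      \<open>s + r - Suc r = s - 1\<close>.\<close>
    also have "\<dots> = (if j = 0 then {} else {s - 1}) \<union> (if Suc j < m then {s + r} else {})"
      by (cases j) (simp_all add: s_def ac_simps)
    finally have cR: "c ` R =
      (if j = 0 then {} else {s - 1}) \<union> (if Suc j < m then {s + r} else {})" .
    \<comment> \<open>This keeps the truncated \<open>s - 1\<close> strictly below \<open>s\<close>,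
      hence apart from the colours of \<open>A\<close>.\<close>
    have "s \<ge> 1"
      using a_bounds[OF v] by (simp add: s_def)
    have "inj_on \<alpha> (incident_edges G v)"
      using col v by (simp add: interval_coloring_def)
    then have "inj_on c A"
      unfolding A_def by (auto simp: inj_on_def c_copy E)
    moreover have "inj_on c R"
      unfolding R_def inj_on_def using c_rung by auto
    moreover have "c ` A \<inter> c ` R = {}"
      unfolding cA cR using \<open>s \<ge> 1\<close> by auto
    ultimately have "inj_on c (A \<union> R)"
      by (auto simp: inj_on_Un)
    moreover have "c ` (A \<union> R) =
        {(if j = 0 then s else s - 1)..(if Suc j < m then s + r else s + r - 1)}"
      unfolding image_Un cA cR using \<open>s \<ge> 1\<close> \<open>r > 0\<close> by auto
    ultimately show ?thesis
      unfolding inc by blast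
  qed
  ultimately show ?thesis
    unfolding interval_coloring_def by (intro exI[of _ c]) auto
qed

theorem theorem9:
  fixes G :: "'a ugraph" and r m :: nat
  assumes "simple_graph G"
    and "regular r G"
    and "interval_colorable G"
    and "m \<ge> 1"
  shows "interval_colorable (G \<box> path_graph m) \<and>
    W (path_graph m) = m - 1 \<and>
    W (G \<box> path_graph m) \<ge> W G + W (path_graph m) + (m - 1) * r"
proof -
  obtain \<alpha> where \<alpha>: "interval_coloring G (W G) \<alpha>" and pos: "W G > 0"
    using W_attained[OF assms(1,3)] .
  \<comment> \<open>Expanding \<open>Suc r\<close> gives \<open>W G + (m - 1) + (m - 1) * r\<close>,
    the required bound.\<close>
  let ?T = "W G + (m - 1) * Suc r"
  obtain c where c: "interval_coloring (G \<box> path_graph m) ?T c"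
    using interval_coloring_product[OF assms(1,2) \<alpha> pos assms(4)] by blast
  have "?T > 0" using pos by simp
  then have "interval_colorable (G \<box> path_graph m)"
    using c unfolding interval_colorable_def by blast
  moreover have "?T \<le> W (G \<box> path_graph m)"
    using W_ge[OF simple_cartesian_product[OF assms(1) simple_path_graph] c \<open>?T > 0\<close>] .
  ultimately show ?thesis
    by (simp add: W_path_graph)
qed

end
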